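(* Let $X$ be a real Hilbert space, $\mathcal P:X\to X$ a bounded linear projection with range $V$ and kernel $W$, $q:X\to\mathbb R$ a continuous quadratic function with second derivative $b=q''$, $\tilde V\subset X$ a closed linear subspace, and $\tilde b$ a bounded symmetric bilinear form that is elliptic on $\tilde V$. Suppose $V\subset W+\tilde V$. Assume there are constants $\Gamma\ge\gamma>0$ such that $$\gamma \min_{w\in [v]\cap \tilde V}\tilde b(w,w)\;\le\; b(v,v)\;\le\;\Gamma \min_{w\in [v]\cap\tilde V}\tilde b(w,w)\qquad\text{for all } v\in V,$$ where $[v]=v+W$. Let $\kappa:=\Gamma/\gamma$ and let $x_*$ be the minimizer of $q$ over $V$. Then the PDP algorithm (started at any $x_0\in V$) and the steepest descent algorithm in $X/W$ (started at $[\xi_0]\in X/W$ with $x_0\in[\xi_0]$) converge linearly in the norm induced by $b$, namely $\|[v]\|_b:=\|\mathcal P v\|_b=b(\mathcal Pv,\mathcal Pv)^{1/2}$ on $X/W$ (which is $\|v\|_b=b(v,v)^{1/2}$ for $v\in V$): $$\|x_{k+1}-x_*\|_b\le\Theta\,\|x_k-x_*\|_b\qquad\text{and}\qquad \|[\xi_{k+1}]-[x_*]\|_b\le\Theta\,\|[\xi_k]-[x_*]\|_b\qquad\text{for all }k\ge0,$$ with rate $$\Theta=\frac{\kappa-1}{\kappa+1}.$$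
   Context: Setting: $X$ is a real Hilbert space with dual $X^*$; $q:X\to\mathbb R$ is continuous and quadratic, so $b:=q''(x)$ is a bounded symmetric bilinear form independent of $x$ and $q(x+\delta x)=q(x)+q'(x)\delta x+\tfrac12 b(\delta x,\delta x)$. $\mathcal P:X\to X$ is a bounded linear (not necessarily orthogonal) projection, $V=\operatorname{ran}\mathcal P$, $W=\ker\mathcal P$, and $\mathcal P^*:X^*\to X^*$ is its adjoint. The problem is $\min_{x\in V}q(x)$. $\tilde V\subset X$ is a closed linear subspace and $\tilde b$ is a bounded symmetric bilinear form, elliptic on $\tilde V$ (there is $\alpha>0$ with $\tilde b(v,v)\ge\alpha\|v\|^2$ for all $v\in\tilde V$). PDP (primal dual projection) algorithm, initial iterate $x_0\in V$; for $k=0,1,2,\dots$: 1. $\lambda_k=\mathcal P^*q'(x_k)-q'(x_k)\in X^*$; 2. $\delta y_k=\operatorname{arg\,min}_{v\in\tilde V}\; q'(x_k)v+\tfrac12\tilde b(v,v)+\lambda_k v$; 3. $\delta x_k=\mathcal P\,\delta y_k$; 4. $x_{k+1}=x_k+\omega_k\delta x_k$ with $\omega_k=-\dfrac{q'(x_k)\delta x_k}{b(\delta x_k,\delta x_k)}$ (if $\delta x_k=0$, set $x_{k+1}=x_k$). Steepest descent algorithm in $X/W$: elements of the quotient space $X/W$ are classes $[\xi]=\xi+W$. Define $f:X/W\to\mathbb R$ by $f([\xi])=q(\mathcal P\xi)$, so $f'([\xi])[v]=q'(\mathcal P\xi)\mathcal Pv$ and $f''([\xi])([v],[v])=b(\mathcal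 Pv,\mathcal Pv)$, and $\langle[v],[v]\rangle:=\inf_{\nu\in[v]\cap\tilde V}\tilde b(\nu,\nu)$. Given $[\xi_0]\in X/W$, for $k=0,1,2,\dots$: 1. $[\delta\xi_k]=\operatorname{arg\,min}_{[v]\in X/W}\;\tfrac12\langle[v],[v]\rangle+f'([\xi_k])[v]$; 2. $\omega_k=-\dfrac{f'([\xi_k])[\delta\xi_k]}{f''([\xi_k])([\delta\xi_k],[\delta\xi_k])}$; 3. $[\xi_{k+1}]=[\xi_k]+\omega_k[\delta\xi_k]$ (if $[\delta\xi_k]=0$, set $[\xi_{k+1}]=[\xi_k]$). *)

theory Defs
  imports "HOL-Analysis.Analysis" "HOL-Library.Set_Algebras"
begin

text \<open>
  The dual space \<open>X\<^sup>*\<close> is \<open>'a \<Rightarrow>\<^sub>L real\<close>, and a bounded bilinear form on \<open>X\<close> is an element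
  of \<open>'a \<Rightarrow>\<^sub>L 'a \<Rightarrow>\<^sub>L real\<close>.
\<close>

definition quadratic :: "('a::real_vector \<Rightarrow> real) \<Rightarrow> bool" where
  "quadratic q \<longleftrightarrow> (\<exists>B l c. bilinear B \<and> (\<forall>x y. B x y = B y x) \<and> linear l \<and>
     (\<forall>x. q x = (1/2) * B x x + l x + c))"

definition symmetric_form :: "('a::real_normed_vector \<Rightarrow>\<^sub>L 'a \<Rightarrow>\<^sub>L real) \<Rightarrow> bool" where
  "symmetric_form B \<longleftrightarrow> (\<forall>x y. B x y = B y x)"

definition elliptic_on :: "'a set \<Rightarrow> ('a::real_normed_vector \<Rightarrow>\<^sub>L 'a \<Rightarrow>\<^sub>L real) \<Rightarrow> bool" where
  "elliptic_on S B \<longleftrightarrow> (\<exists>\<alpha>>0. \<forall>v\<in>S. B v v \<ge> \<alpha> * (norm v)\<^sup>2)"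

text \<open>The smallest value of \<open>f\<close> on \<open>S\<close>; unlike \<open>Inf\<close> it is meaningful only if it is attained.\<close>

definition min_value :: "('a \<Rightarrow> real) \<Rightarrow> 'a set \<Rightarrow> real" where
  "min_value f S = (LEAST r. r \<in> f ` S)"

definition form_norm :: "('a::real_normed_vector \<Rightarrow>\<^sub>L 'a \<Rightarrow>\<^sub>L real) \<Rightarrow> 'a \<Rightarrow> real" where
  "form_norm b v = sqrt (b v v)"

definition dual_adjoint ::
    "('a::real_normed_vector \<Rightarrow>\<^sub>L 'a) \<Rightarrow> ('a \<Rightarrow>\<^sub>L real) \<Rightarrow> ('a \<Rightarrow>\<^sub>L real)" where
  "dual_adjoint P l = l o\<^sub>L P"


text \<open>Here \<open>dq\<close> is the derivative \<open>q'\<close>, \<open>b = q''\<close>, \<open>bt\<close> is \<open>b\<close> tilde and \<open>Vt\<close> is \<open>V\<close> tilde.\<close>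

definition pdp_multiplier ::
    "('a::real_normed_vector \<Rightarrow> 'a \<Rightarrow>\<^sub>L real) \<Rightarrow> ('a \<Rightarrow>\<^sub>L 'a) \<Rightarrow> 'a \<Rightarrow> ('a \<Rightarrow>\<^sub>L real)" where
  "pdp_multiplier dq P x = dual_adjoint P (dq x) - dq x"

definition pdp_step ::
    "('a::real_normed_vector \<Rightarrow> 'a \<Rightarrow>\<^sub>L real) \<Rightarrow> ('a \<Rightarrow>\<^sub>L 'a \<Rightarrow>\<^sub>L real) \<Rightarrow> ('a \<Rightarrow>\<^sub>L 'a \<Rightarrow>\<^sub>L real) \<Rightarrow>
     'a set \<Rightarrow> ('a \<Rightarrow>\<^sub>L 'a) \<Rightarrow> 'a \<Rightarrow> 'a" where
  "pdp_step dq b bt Vt P x =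
    (let lam = pdp_multiplier dq P x;
         dy = arg_min_on (\<lambda>v. dq x v + (1/2) * bt v v + lam v) Vt;
         dx = P dy;
         om = - (dq x dx) / b dx dx
     in if dx = 0 then x else x + om *\<^sub>R dx)"

primrec pdp ::
    "('a::real_normed_vector \<Rightarrow> 'a \<Rightarrow>\<^sub>L real) \<Rightarrow> ('a \<Rightarrow>\<^sub>L 'a \<Rightarrow>\<^sub>L real) \<Rightarrow> ('a \<Rightarrow>\<^sub>L 'a \<Rightarrow>\<^sub>L real) \<Rightarrow>
     'a set \<Rightarrow> ('a \<Rightarrow>\<^sub>L 'a) \<Rightarrow> 'a \<Rightarrow> nat \<Rightarrow> 'a" where
  "pdp dq b bt Vt P x0 0 = x0"
| "pdp dq b bt Vt P x0 (Suc k) = pdp_step dq b bt Vt P (pdp dq b bt Vt P x0 k)"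


text \<open>
  The class of \<open>\<xi>\<close> is the coset \<open>\<xi> +o W\<close>, and the sum of two cosets is their elementwise sum
  \<open>A + B\<close>.  Multiplication by \<open>r\<close> adds \<open>W\<close> in order to yield \<open>W\<close>, not \<open>{0}\<close>, for \<open>r = 0\<close>.
  Beware that \<open>A - B\<close> is set difference.
\<close>

definition quotient_space :: "'a::real_vector set \<Rightarrow> 'a set set" where
  "quotient_space W = range (\<lambda>\<xi>. \<xi> +o W)"

definition coset_scale :: "'a::real_vector set \<Rightarrow> real \<Rightarrow> 'a set \<Rightarrow> 'a set" where
  "coset_scale W r A = (\<lambda>x. r *\<^sub>R x) ` A + W"

definition coset_minus :: "'a::real_vector set \<Rightarrow> 'a set \<Rightarrow> 'a set \<Rightarrow> 'a set" where
  "coset_minus W A B = A + coset_scale W (-1) B"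

abbreviation ker :: "('a::real_normed_vector \<Rightarrow>\<^sub>L 'a) \<Rightarrow> 'a set" where
  "ker P \<equiv> {x. P x = 0}"

text \<open>
  A function which is constant on a coset \<open>A\<close> has a singleton as its image of \<open>A\<close>, whence the use
  of \<open>the_elem\<close> for functions on classes.
\<close>

definition quot_f :: "('a::real_normed_vector \<Rightarrow> real) \<Rightarrow> ('a \<Rightarrow>\<^sub>L 'a) \<Rightarrow> 'a set \<Rightarrow> real" where
  "quot_f q P A = the_elem ((\<lambda>\<xi>. q (P \<xi>)) ` A)"

definition quot_norm ::
    "('a::real_normed_vector \<Rightarrow>\<^sub>L 'a \<Rightarrow>\<^sub>L real) \<Rightarrow> ('a \<Rightarrow>\<^sub>L 'a) \<Rightarrow> 'a set \<Rightarrow> real" where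
  "quot_norm b P A = the_elem ((\<lambda>v. form_norm b (P v)) ` A)"

text \<open>
  \<open>f'(A)[B]\<close> and \<open>f''(A)(B,C)\<close> as iterated directional derivatives of \<open>f\<close>; the formulas in terms
  of \<open>q'\<close> and \<open>q''\<close> are \<open>quot_f'_eq\<close> and \<open>quot_f''_eq\<close> below.
\<close>

definition quot_f' ::
    "('a::real_normed_vector \<Rightarrow> real) \<Rightarrow> ('a \<Rightarrow>\<^sub>L 'a) \<Rightarrow> 'a set \<Rightarrow> 'a set \<Rightarrow> real" where
  "quot_f' q P A B = deriv (\<lambda>t. quot_f q P (A + coset_scale (ker P) t B)) 0"

definition quot_f'' ::
    "('a::real_normed_vector \<Rightarrow> real) \<Rightarrow> ('a \<Rightarrow>\<^sub>L 'a) \<Rightarrow> 'a set \<Rightarrow> 'a set \<Rightarrow> 'a set \<Rightarrow> real" where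
  "quot_f'' q P A B C = deriv (\<lambda>t. quot_f' q P (A + coset_scale (ker P) t C) B) 0"

text \<open>The quadratic form \<open>\<langle>A,A\<rangle>\<close> induced by \<open>bt\<close>.\<close>

definition quot_form ::
    "('a::real_normed_vector \<Rightarrow>\<^sub>L 'a \<Rightarrow>\<^sub>L real) \<Rightarrow> 'a set \<Rightarrow> 'a set \<Rightarrow> real" where
  "quot_form bt Vt A = (INF \<nu>\<in>A \<inter> Vt. bt \<nu> \<nu>)"

definition sd_step ::
    "('a::real_normed_vector \<Rightarrow> real) \<Rightarrow> ('a \<Rightarrow>\<^sub>L 'a \<Rightarrow>\<^sub>L real) \<Rightarrow> 'a set \<Rightarrow> ('a \<Rightarrow>\<^sub>L 'a) \<Rightarrow>
     'a set \<Rightarrow> 'a set" where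
  "sd_step q bt Vt P A =
    (let W = ker P;
         D = arg_min_on (\<lambda>B. (1/2) * quot_form bt Vt B + quot_f' q P A B) (quotient_space W);
         om = - (quot_f' q P A D) / quot_f'' q P A D D
     in if D = W then A else A + coset_scale W om D)"

primrec sd ::
    "('a::real_normed_vector \<Rightarrow> real) \<Rightarrow> ('a \<Rightarrow>\<^sub>L 'a \<Rightarrow>\<^sub>L real) \<Rightarrow> 'a set \<Rightarrow> ('a \<Rightarrow>\<^sub>L 'a) \<Rightarrow>
     'a set \<Rightarrow> nat \<Rightarrow> 'a set" where
  "sd q bt Vt P A0 0 = A0"
| "sd q bt Vt P A0 (Suc k) = sd_step q bt Vt P (sd q bt Vt P A0 k)"


lemma mem_cosetE:
  fixes P :: "'a::real_normed_vector \<Rightarrow>\<^sub>L 'a"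
  assumes "x \<in> \<xi> +o ker P"
  shows "P x = P \<xi>"
  using assms by (auto simp: elt_set_plus_def blinfun.add_right)

lemma mem_coset_self: "\<xi> \<in> \<xi> +o ker P"
  by (auto simp: elt_set_plus_def blinfun.zero_right)

lemma the_elem_coset:
  fixes P :: "'a::real_normed_vector \<Rightarrow>\<^sub>L 'a"
  shows "the_elem ((\<lambda>x. g (P x)) ` (\<xi> +o ker P)) = g (P \<xi>)"
proof -
  have "(\<lambda>x. g (P x)) ` (\<xi> +o ker P) = {g (P \<xi>)}"
  proof (intro equalityI subsetI)
    fix y assume "y \<in> (\<lambda>x. g (P x)) ` (\<xi> +o ker P)"
    then obtain x where "x \<in> \<xi> +o ker P" "y = g (P x)" by blast
    then show "y \<in> {g (P \<xi>)}" by (simp add: mem_cosetE)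
  qed (use mem_coset_self[of \<xi> P] in blast)
  then show ?thesis by simp
qed

lemma quot_f_coset: "quot_f q P (\<xi> +o ker P) = q (P \<xi>)"
  unfolding quot_f_def by (rule the_elem_coset)

lemma quot_norm_coset: "quot_norm b P (v +o ker P) = form_norm b (P v)"
  unfolding quot_norm_def by (rule the_elem_coset)

lemma coset_add_scale:
  fixes P :: "'a::real_normed_vector \<Rightarrow>\<^sub>L 'a"
  shows "(\<xi> +o ker P) + coset_scale (ker P) t (v +o ker P) = (\<xi> + t *\<^sub>R v) +o ker P"
proof (intro set_eqI iffI)
  fix x assume "x \<in> (\<xi> +o ker P) + coset_scale (ker P) t (v +o ker P)"
  then obtain a c d where x: "x = (\<xi> + a) + (t *\<^sub>R (v + c) + d)" and "P a = 0" "P c = 0" "P d = 0"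
    by (auto simp: set_plus_def elt_set_plus_def coset_scale_def)
  then have "x = (\<xi> + t *\<^sub>R v) + (a + t *\<^sub>R c + d)" "a + t *\<^sub>R c + d \<in> ker P"
    by (simp_all add: algebra_simps blinfun.add_right blinfun.scaleR_right)
  then show "x \<in> (\<xi> + t *\<^sub>R v) +o ker P"
    unfolding elt_set_plus_def by blast
next
  fix x assume "x \<in> (\<xi> + t *\<^sub>R v) +o ker P"
  then obtain d where d: "x = \<xi> + (t *\<^sub>R v + d)" "d \<in> ker P"
    by (auto simp: elt_set_plus_def add.assoc)
  have "t *\<^sub>R v + d \<in> coset_scale (ker P) t (v +o ker P)"
    unfolding coset_scale_def by (rule set_plus_intro) (use d mem_coset_self in auto)
  with d show "x \<in> (\<xi> +o ker P) + coset_scale (ker P) t (v +o ker P)"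
    using mem_coset_self[of \<xi> P] by auto
qed

lemma quot_f'_eq:
  fixes P :: "'a::real_normed_vector \<Rightarrow>\<^sub>L 'a" and dq :: "'a \<Rightarrow> 'a \<Rightarrow>\<^sub>L real"
  assumes "\<And>x. (q has_derivative dq x) (at x)"
  shows "quot_f' q P (\<xi> +o ker P) (v +o ker P) = dq (P \<xi>) (P v)"
proof -
  have "((\<lambda>t. q (P \<xi> + t *\<^sub>R P v)) has_derivative (\<lambda>t. dq (P \<xi>) (t *\<^sub>R P v))) (at (0::real))"
  proof (rule has_derivative_compose[where g = q and f = "\<lambda>t. P \<xi> + t *\<^sub>R P v"])
    show "((\<lambda>t. P \<xi> + t *\<^sub>R P v) has_derivative (\<lambda>t. t *\<^sub>R P v)) (at (0::real))"
      by (auto intro!: derivative_eq_intros)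
    show "(q has_derivative dq (P \<xi>)) (at (P \<xi> + 0 *\<^sub>R P v))"
      using assms by simp
  qed
  then have "((\<lambda>t. q (P \<xi> + t *\<^sub>R P v)) has_real_derivative dq (P \<xi>) (P v)) (at 0)"
    by (rule has_derivative_imp_has_field_derivative) (simp add: blinfun.scaleR_right)
  then show ?thesis
    unfolding quot_f'_def coset_add_scale quot_f_coset
    by (simp add: DERIV_imp_deriv blinfun.add_right blinfun.scaleR_right)
qed

lemma quot_f''_eq:
  fixes P :: "'a::real_normed_vector \<Rightarrow>\<^sub>L 'a" and dq :: "'a \<Rightarrow> 'a \<Rightarrow>\<^sub>L real"
    and b :: "'a \<Rightarrow>\<^sub>L 'a \<Rightarrow>\<^sub>L real"
  assumes "\<And>x. (q has_derivative dq x) (at x)" and "\<And>x. (dq has_derivative b) (at x)"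
  shows "quot_f'' q P (\<xi> +o ker P) (v +o ker P) (w +o ker P) = b (P w) (P v)"
proof -
  have "((\<lambda>t. dq (P \<xi> + t *\<^sub>R P w)) has_derivative (\<lambda>t. b (t *\<^sub>R P w))) (at (0::real))"
  proof (rule has_derivative_compose[where g = dq and f = "\<lambda>t. P \<xi> + t *\<^sub>R P w"])
    show "((\<lambda>t. P \<xi> + t *\<^sub>R P w) has_derivative (\<lambda>t. t *\<^sub>R P w)) (at (0::real))"
      by (auto intro!: derivative_eq_intros)
    show "(dq has_derivative b) (at (P \<xi> + 0 *\<^sub>R P w))"
      using assms by simp
  qed
  then have "((\<lambda>t. dq (P \<xi> + t *\<^sub>R P w) (P v)) has_derivative (\<lambda>t. b (t *\<^sub>R P w) (P v))) (at (0::real))"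
    by (rule bounded_linear.has_derivative[OF blinfun.bounded_linear_left])
  then have "((\<lambda>t. dq (P \<xi> + t *\<^sub>R P w) (P v)) has_real_derivative b (P w) (P v)) (at 0)"
    by (rule has_derivative_imp_has_field_derivative)
      (simp add: blinfun.scaleR_right blinfun.scaleR_left)
  then show ?thesis
    unfolding quot_f''_def coset_add_scale quot_f'_eq[OF assms(1)]
    by (simp add: DERIV_imp_deriv blinfun.add_right blinfun.scaleR_right)
qed

end

theory Submission
  imports Defs
begin

text \<open>
  Both algorithms are the same method: steepest descent for \<open>q\<close> on \<open>V\<close> with exact line search,
  where the gradient is taken in the inner product that \<open>bt\<close> induces on \<open>V\<close> via \<open>X / W\<close>.

  Let \<open>e = x - xs\<close> be the error of an iterate \<open>x \<in> V\<close>.  As \<open>q'\<close> vanishes on \<open>V\<close> at \<open>xs\<close>, we have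
  \<open>q'(x) v = b e v\<close> for \<open>v \<in> V\<close>.  The multiplier turns \<open>q'(x) v\<close> into \<open>q'(x) (P v)\<close>, so that
  the direction \<open>y\<close> computed in \<open>Vt\<close> is characterised by \<open>bt y w = - b e (P w)\<close> for all \<open>w \<in> Vt\<close>
  (\<open>local_model_min_descent_direction\<close>).  In particular \<open>y\<close> is \<open>bt\<close>-orthogonal to \<open>Vt \<inter> W\<close>, that
  is, \<open>y\<close> has the least \<open>bt\<close>-energy in its class.  For the same reason a minimizer over \<open>X / W\<close>
  is nothing but the class of such a \<open>y\<close> (\<open>quot_model_min_lift\<close>), and one estimate serves both
  methods.

  The exact step turns the error \<open>e\<close> into \<open>e'\<close> with
  \<open>b e' e' = b e e - (b e (P y))\<^sup>2 / b (P y) (P y)\<close>, so that the rate is a Kantorovich inequality.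
  It usually comes from the spectral theorem; here a two-dimensional argument
  suffices.  Let \<open>z\<close> be the representative of \<open>e\<close> of least energy.  The \<open>bt\<close>-orthogonal complement
  of \<open>Vt \<inter> W\<close> in \<open>Vt\<close> contains \<open>z\<close> and \<open>y\<close>, and on it the hypothesis reads
  \<open>\<gamma> * bt w w \<le> b (P w) (P w) \<le> \<Gamma> * bt w w\<close>.  If \<open>A\<close> is the operator with
  \<open>bt (A w) w' = b (P w) (P w')\<close>, then \<open>- y = A z\<close>, and the Gram matrices of the two forms on the
  span of \<open>z\<close> and \<open>- y\<close> are the Hankel matrices of the moments \<open>m\<^sub>i = bt (A\<^sup>i z) z\<close> for
  \<open>i \<le> 2\<close> and \<open>1 \<le> i \<le> 3\<close>.  Their comparison yields \<open>m\<^sub>3 + \<gamma> \<Gamma> m\<^sub>1 \<le> (\<gamma> + \<Gamma>) m\<^sub>2\<close>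
  (\<open>third_moment_le\<close>), from which the rate follows by the inequality between the arithmetic and
  the geometric mean (\<open>exact_line_search_reduction\<close>).
\<close>

section \<open>Minimizers of quadratic functionals\<close>

text \<open>
  The parallelogram identity bounds the distance of two points by how far their values exceed the
  infimum, so a minimizing sequence is Cauchy.
\<close>

lemma quadratic_form_attains_min:
  fixes B :: "'a::{real_inner, complete_space} \<Rightarrow>\<^sub>L 'a \<Rightarrow>\<^sub>L real" and l :: "'a \<Rightarrow>\<^sub>L real"
  assumes S: "subspace S" and sym: "symmetric_form B" and ell: "elliptic_on S B"
    and C: "C \<subseteq> S" "closed C" "convex C" "C \<noteq> {}"
  shows "\<exists>y. is_arg_min (\<lambda>v. (1/2) * B v v + l v) (\<lambda>v. v \<in> C) y"
proof -
  let ?J = "\<lambda>v. (1/2) * B v v + l v"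
  from ell obtain \<alpha> where \<alpha>: "\<alpha> > 0" and el: "\<And>v. v \<in> S \<Longrightarrow> \<alpha> * (norm v)\<^sup>2 \<le> B v v"
    unfolding elliptic_on_def by blast
  have Bsym: "B u v = B v u" for u v
    using sym unfolding symmetric_form_def by blast
  define d where "d = Inf (?J ` C)"
  \<comment> \<open>Complete the square in \<open>\<alpha> / 2 * (norm v)\<^sup>2 - norm l * norm v\<close>.\<close>
  have bdd: "bdd_below (?J ` C)"
  proof (rule bdd_belowI2[where m = "- (norm l)\<^sup>2 / (2 * \<alpha>)"])
    fix v assume "v \<in> C"
    then have "\<alpha> * (norm v)\<^sup>2 \<le> B v v" using el C(1) by blast
    moreover have "- (norm l * norm v) \<le> l v"
      using norm_blinfun[of l v] by simp
    moreover have "0 \<le> (\<alpha> * norm v - norm l)\<^sup>2 / (2 * \<alpha>)"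
      using \<alpha> by simp
    then have "- (norm l)\<^sup>2 / (2 * \<alpha>) \<le> (1/2) * (\<alpha> * (norm v)\<^sup>2) - norm l * norm v"
      using \<alpha> by (simp add: field_simps power2_eq_square)
    ultimately show "- (norm l)\<^sup>2 / (2 * \<alpha>) \<le> ?J v" by linarith
  qed
  have d_le: "d \<le> ?J v" if "v \<in> C" for v
    unfolding d_def using bdd that by (rule cINF_lower)
  have "\<exists>v\<in>C. ?J v < d + inverse (real (Suc n))" for n
  proof -
    have "Inf (?J ` C) < d + inverse (real (Suc n))" unfolding d_def by simp
    then show ?thesis using C(4) bdd by (simp add: cINF_less_iff)
  qed
  then obtain X where X: "\<And>n. X n \<in> C" and XJ: "\<And>n. ?J (X n) < d + inverse (real (Suc n))"
    by metis
  have gap: "\<alpha> * (norm (u - v))\<^sup>2 \<le> 4 * ((?J u - d) + (?J v - d))" if "u \<in> C" "v \<in> C" for u v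
  proof -
    have "(1/2) *\<^sub>R u + (1/2) *\<^sub>R v \<in> C"
      using C(3) that by (intro convexD) auto
    then have "d \<le> ?J ((1/2) *\<^sub>R u + (1/2) *\<^sub>R v)" by (rule d_le)
    moreover have "8 * ?J ((1/2) *\<^sub>R u + (1/2) *\<^sub>R v) = 4 * (?J u + ?J v) - B (u - v) (u - v)"
      using Bsym[of u v]
      by (simp add: blinfun.add_left blinfun.add_right blinfun.scaleR_left blinfun.scaleR_right
          blinfun.diff_left blinfun.diff_right field_simps)
    ultimately have "B (u - v) (u - v) \<le> 4 * ((?J u - d) + (?J v - d))"
      unfolding right_diff_distrib distrib_left by linarith
    moreover have "u - v \<in> S" using that C(1) S by (auto intro: subspace_diff)
    ultimately show ?thesis using el by fastforce
  qed
  have "Cauchy X"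
  proof (rule metric_CauchyI)
    fix e :: real assume e: "e > 0"
    then have "0 < \<alpha> * e\<^sup>2 / 8" using \<alpha> by simp
    then obtain N where N: "inverse (real (Suc N)) < \<alpha> * e\<^sup>2 / 8"
      using reals_Archimedean by blast
    have small: "?J (X n) - d < \<alpha> * e\<^sup>2 / 8" if "n \<ge> N" for n
    proof -
      have "inverse (real (Suc n)) \<le> inverse (real (Suc N))"
        using that by (simp add: le_imp_inverse_le)
      then show ?thesis using XJ[of n] N by linarith
    qed
    have "dist (X m) (X n) < e" if "m \<ge> N" "n \<ge> N" for m n
    proof -
      have "\<alpha> * (norm (X m - X n))\<^sup>2 < \<alpha> * e\<^sup>2"
        using gap[OF X[of m] X[of n]] small[OF that(1)] small[OF that(2)]
        unfolding right_diff_distrib distrib_left by linarith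
      then have "(norm (X m - X n))\<^sup>2 < e\<^sup>2" using \<alpha> by simp
      then show ?thesis
        using e by (simp add: dist_norm power_less_imp_less_base)
    qed
    then show "\<exists>M. \<forall>m\<ge>M. \<forall>n\<ge>M. dist (X m) (X n) < e" by blast
  qed
  then obtain y where y: "X \<longlonglongrightarrow> y" using Cauchy_convergent convergent_def by blast
  have yC: "y \<in> C" using C(2) X y closed_sequentially by blast
  have "(\<lambda>n. ?J (X n)) \<longlonglongrightarrow> ?J y"
    by (intro tendsto_intros y)
  moreover have "(\<lambda>n. d + inverse (real (Suc n))) \<longlonglongrightarrow> d + 0"
    by (intro tendsto_intros LIMSEQ_inverse_real_of_nat)
  ultimately have "?J y \<le> d + 0"
    by (rule LIMSEQ_le) (use XJ less_imp_le in blast)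
  then have "\<forall>v. v \<in> C \<longrightarrow> ?J y \<le> ?J v" using d_le by fastforce
  then show ?thesis using yC unfolding is_arg_min_linorder by blast
qed

text \<open>
  Minimality is required only along the line through \<open>y\<close> in direction \<open>w\<close>, so that the lemma
  applies to subspaces, affine spaces and cosets alike.
\<close>

lemma quadratic_form_min_stationary:
  fixes B :: "'a::real_normed_vector \<Rightarrow>\<^sub>L 'a \<Rightarrow>\<^sub>L real" and l :: "'a \<Rightarrow>\<^sub>L real"
  assumes sym: "symmetric_form B"
    and min: "\<And>t. (1/2) * B y y + l y \<le> (1/2) * B (y + t *\<^sub>R w) (y + t *\<^sub>R w) + l (y + t *\<^sub>R w)"
  shows "B y w + l w = 0"
proof -
  define p where "p = B y w + l w"
  have Bsym: "B w y = B y w"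
    using sym unfolding symmetric_form_def by blast
  have nonneg: "0 \<le> t * p + t\<^sup>2 * (B w w / 2)" for t
    using min[of t] Bsym
    by (simp add: p_def blinfun.add_left blinfun.add_right blinfun.scaleR_left blinfun.scaleR_right
        field_simps power2_eq_square)
  have "((\<lambda>t. t * p + t\<^sup>2 * (B w w / 2)) has_real_derivative p) (at 0)"
    by (auto intro!: derivative_eq_intros)
  then have "p = 0"
    by (rule DERIV_local_min[where d = 1]) (use nonneg in auto)
  then show ?thesis by (simp add: p_def)
qed

text \<open>
  The bilinear and the linear part of a quadratic function are not assumed to be bounded.  As
  directional derivatives along lines they nevertheless coincide with \<open>q''\<close> and \<open>q'(0)\<close>, which
  gives the symmetry of \<open>q''\<close> and the expansion of \<open>q\<close>.
\<close>

lemma quadratic_derivatives: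
  fixes q :: "'a::real_normed_vector \<Rightarrow> real"
    and dq :: "'a \<Rightarrow> 'a \<Rightarrow>\<^sub>L real" and b :: "'a \<Rightarrow>\<^sub>L 'a \<Rightarrow>\<^sub>L real"
  assumes quad: "quadratic q"
    and dq: "\<And>x. (q has_derivative dq x) (at x)"
    and b: "\<And>x. (dq has_derivative b) (at x)"
  shows "symmetric_form b"
    and "dq x v = b x v + dq 0 v"
    and "q x = (1/2) * b x x + dq 0 x + q 0"
proof -
  from quad obtain B l c where B: "bilinear B" and Bsym: "\<And>x y. B x y = B y x" and l: "linear l"
    and q: "\<And>x. q x = (1/2) * B x x + l x + c"
    unfolding quadratic_def by blast
  note B_simps = bilinear_ladd[OF B] bilinear_radd[OF B] bilinear_lmul[OF B] bilinear_rmul[OF B]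
    linear_add[OF l] linear_cmul[OF l]
  have dq_eq: "dq x v = B x v + l v" for x v
  proof -
    have "((\<lambda>t. q (x + t *\<^sub>R v)) has_derivative (\<lambda>t. dq x (t *\<^sub>R v))) (at (0::real))"
    proof (rule has_derivative_compose[where g = q and f = "\<lambda>t. x + t *\<^sub>R v"])
      show "((\<lambda>t. x + t *\<^sub>R v) has_derivative (\<lambda>t. t *\<^sub>R v)) (at (0::real))"
        by (auto intro!: derivative_eq_intros)
    qed (use dq in simp)
    then have "((\<lambda>t. q (x + t *\<^sub>R v)) has_real_derivative dq x v) (at 0)"
      by (rule has_derivative_imp_has_field_derivative) (simp add: blinfun.scaleR_right)
    moreover have "(\<lambda>t. q (x + t *\<^sub>R v))
        = (\<lambda>t. q x + t * (B x v + l v) + t\<^sup>2 * (B v v / 2))"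
      using Bsym[of v x] by (auto simp: q B_simps field_simps power2_eq_square)
    then have "((\<lambda>t. q (x + t *\<^sub>R v)) has_real_derivative B x v + l v) (at 0)"
      by (auto intro!: derivative_eq_intros)
    ultimately show ?thesis by (rule DERIV_unique)
  qed
  have b_eq: "b h v = B h v" for h v
  proof -
    have "((\<lambda>t. dq (0 + t *\<^sub>R h)) has_derivative (\<lambda>t. b (t *\<^sub>R h))) (at (0::real))"
    proof (rule has_derivative_compose[where g = dq and f = "\<lambda>t. 0 + t *\<^sub>R h"])
      show "((\<lambda>t. 0 + t *\<^sub>R h) has_derivative (\<lambda>t. t *\<^sub>R h)) (at (0::real))"
        by (auto intro!: derivative_eq_intros)
    qed (use b in simp)
    then have "((\<lambda>t. dq (0 + t *\<^sub>R h) v) has_derivative (\<lambda>t. b (t *\<^sub>R h) v)) (at (0::real))"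
      by (rule bounded_linear.has_derivative[OF blinfun.bounded_linear_left])
    then have "((\<lambda>t. dq (0 + t *\<^sub>R h) v) has_real_derivative b h v) (at 0)"
      by (rule has_derivative_imp_has_field_derivative)
        (simp add: blinfun.scaleR_right blinfun.scaleR_left)
    moreover have "((\<lambda>t. dq (0 + t *\<^sub>R h) v) has_real_derivative B h v) (at 0)"
      unfolding dq_eq by (auto simp: B_simps bilinear_lzero[OF B] intro!: derivative_eq_intros)
    ultimately show ?thesis by (rule DERIV_unique)
  qed
  show "symmetric_form b" unfolding symmetric_form_def b_eq using Bsym by simp
  have dq0: "dq 0 v = l v" for v by (simp add: dq_eq bilinear_lzero[OF B])
  show "dq x v = b x v + dq 0 v" by (simp add: b_eq dq_eq bilinear_lzero[OF B])
  show "q x = (1/2) * b x x + dq 0 x + q 0"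
    by (simp add: dq0 b_eq q bilinear_lzero[OF B] linear_0[OF l])
qed

section \<open>A Kantorovich inequality from four moments\<close>

text \<open>
  Think of \<open>m\<^sub>i\<close> as the moments of a positive measure on \<open>[\<gamma>, \<Gamma>]\<close>: the claim is the integral of
  \<open>\<lambda> (\<lambda> - \<gamma>) (\<Gamma> - \<lambda>) \<ge> 0\<close>, and the hypotheses say that \<open>\<sigma>\<^sup>2 (\<lambda> - \<gamma>)\<close> and
  \<open>\<sigma>\<^sup>2 (\<Gamma> - \<lambda>)\<close> have nonnegative integrals for every polynomial \<open>\<sigma>\<close> of degree at most one.  The claim
  follows from the identity
  \<open>(\<Gamma> - \<gamma>) \<lambda> (\<lambda> - \<gamma>) (\<Gamma> - \<lambda>) = \<gamma> (\<Gamma> - \<lambda>)\<^sup>2 (\<lambda> - \<gamma>) + \<Gamma> (\<lambda> - \<gamma>)\<^sup>2 (\<Gamma> - \<lambda>)\<close>.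
\<close>

lemma third_moment_le:
  fixes \<gamma> \<Gamma> m\<^sub>0 m\<^sub>1 m\<^sub>2 m\<^sub>3 :: real
  assumes "0 < \<gamma>" "\<gamma> \<le> \<Gamma>"
    and lower: "\<And>s t. \<gamma> * (s\<^sup>2 * m\<^sub>0 + 2 * s * t * m\<^sub>1 + t\<^sup>2 * m\<^sub>2)
                  \<le> s\<^sup>2 * m\<^sub>1 + 2 * s * t * m\<^sub>2 + t\<^sup>2 * m\<^sub>3"
    and upper: "\<And>s t. s\<^sup>2 * m\<^sub>1 + 2 * s * t * m\<^sub>2 + t\<^sup>2 * m\<^sub>3
                  \<le> \<Gamma> * (s\<^sup>2 * m\<^sub>0 + 2 * s * t * m\<^sub>1 + t\<^sup>2 * m\<^sub>2)"
  shows "m\<^sub>3 + \<gamma> * \<Gamma> * m\<^sub>1 \<le> (\<gamma> + \<Gamma>) * m\<^sub>2"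
proof (cases "\<gamma> = \<Gamma>")
  case True
  \<comment> \<open>The identity degenerates, but now the two forms are proportional.\<close>
  then have eq: "s\<^sup>2 * m\<^sub>1 + 2 * s * t * m\<^sub>2 + t\<^sup>2 * m\<^sub>3
      = \<gamma> * (s\<^sup>2 * m\<^sub>0 + 2 * s * t * m\<^sub>1 + t\<^sup>2 * m\<^sub>2)" for s t
    using lower[of s t] upper[of s t] by simp
  from eq[of 1 0] eq[of 0 1] eq[of 1 1] have "m\<^sub>2 = \<gamma> * m\<^sub>1" "m\<^sub>3 = \<gamma> * m\<^sub>2"
    by (simp_all add: algebra_simps)
  then show ?thesis using True by (simp add: algebra_simps)
next
  case False
  have "0 \<le> \<gamma> * (((- \<Gamma>)\<^sup>2 * m\<^sub>1 + 2 * (- \<Gamma>) * 1 * m\<^sub>2 + 1\<^sup>2 * m\<^sub>3)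
             - \<gamma> * ((- \<Gamma>)\<^sup>2 * m\<^sub>0 + 2 * (- \<Gamma>) * 1 * m\<^sub>1 + 1\<^sup>2 * m\<^sub>2))"
    using lower[of "- \<Gamma>" 1] assms(1) by simp
  moreover have "0 \<le> \<Gamma> * (\<Gamma> * ((- \<gamma>)\<^sup>2 * m\<^sub>0 + 2 * (- \<gamma>) * 1 * m\<^sub>1 + 1\<^sup>2 * m\<^sub>2)
             - ((- \<gamma>)\<^sup>2 * m\<^sub>1 + 2 * (- \<gamma>) * 1 * m\<^sub>2 + 1\<^sup>2 * m\<^sub>3))"
    using upper[of "- \<gamma>" 1] assms by simp
  ultimately have "0 \<le> (\<Gamma> - \<gamma>) * ((\<gamma> + \<Gamma>) * m\<^sub>2 - \<gamma> * \<Gamma> * m\<^sub>1 - m\<^sub>3)"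
    by (simp add: algebra_simps power2_eq_square)
  then have "0 \<le> (\<gamma> + \<Gamma>) * m\<^sub>2 - \<gamma> * \<Gamma> * m\<^sub>1 - m\<^sub>3"
    using False assms(2) by (simp add: zero_le_mult_iff)
  then show ?thesis by linarith
qed

text \<open>
  Since \<open>1 - ((\<Gamma> - \<gamma>) / (\<Gamma> + \<gamma>))\<^sup>2 = 4 \<gamma> \<Gamma> / (\<gamma> + \<Gamma>)\<^sup>2\<close>, the claim is
  \<open>4 \<gamma> \<Gamma> m\<^sub>1 m\<^sub>3 \<le> ((\<gamma> + \<Gamma>) m\<^sub>2)\<^sup>2\<close>, which the moment inequality implies because the left side is at most
  \<open>(m\<^sub>3 + \<gamma> \<Gamma> m\<^sub>1)\<^sup>2\<close>.
\<close>

lemma exact_line_search_reduction: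
  fixes \<gamma> \<Gamma> m\<^sub>1 m\<^sub>2 m\<^sub>3 :: real
  assumes "0 < \<gamma>" "\<gamma> \<le> \<Gamma>" "0 \<le> m\<^sub>1" "0 < m\<^sub>3"
    and m: "m\<^sub>3 + \<gamma> * \<Gamma> * m\<^sub>1 \<le> (\<gamma> + \<Gamma>) * m\<^sub>2"
  shows "m\<^sub>1 - m\<^sub>2\<^sup>2 / m\<^sub>3 \<le> ((\<Gamma> - \<gamma>) / (\<Gamma> + \<gamma>))\<^sup>2 * m\<^sub>1"
proof -
  have "4 * \<gamma> * \<Gamma> * (m\<^sub>1 * m\<^sub>3) \<le> (m\<^sub>3 + \<gamma> * \<Gamma> * m\<^sub>1)\<^sup>2"
    using zero_le_power2[of "m\<^sub>3 - \<gamma> * \<Gamma> * m\<^sub>1"] by (simp add: power2_eq_square algebra_simps)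
  also have "\<dots> \<le> ((\<gamma> + \<Gamma>) * m\<^sub>2)\<^sup>2"
    using assms by (intro power_mono m) simp
  finally have "4 * \<gamma> * \<Gamma> * m\<^sub>1 * m\<^sub>3 \<le> (\<gamma> + \<Gamma>)\<^sup>2 * m\<^sub>2\<^sup>2"
    by (simp add: power_mult_distrib)
  then have "4 * \<gamma> * \<Gamma> / (\<gamma> + \<Gamma>)\<^sup>2 * m\<^sub>1 \<le> m\<^sub>2\<^sup>2 / m\<^sub>3"
    using assms by (simp add: divide_simps mult_ac)
  moreover have "((\<Gamma> - \<gamma>) / (\<Gamma> + \<gamma>))\<^sup>2 = 1 - 4 * \<gamma> * \<Gamma> / (\<gamma> + \<Gamma>)\<^sup>2"
    using assms by (simp add: divide_simps) (simp add: power2_eq_square algebra_simps)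
  ultimately show ?thesis by (simp add: left_diff_distrib)
qed

section \<open>Representatives of least energy\<close>

lemma mem_coset_ker_iff:
  fixes P :: "'a::real_normed_vector \<Rightarrow>\<^sub>L 'a"
  shows "x \<in> v +o ker P \<longleftrightarrow> P x = P v"
proof
  assume "P x = P v"
  then have "x = v + (x - v)" "x - v \<in> ker P" by (simp_all add: blinfun.diff_right)
  then show "x \<in> v +o ker P" unfolding elt_set_plus_def by blast
qed (rule mem_cosetE)

locale equivalent_forms =
  fixes P :: "'a::{real_inner, complete_space} \<Rightarrow>\<^sub>L 'a"
    and Vt :: "'a set" and b bt :: "'a \<Rightarrow>\<^sub>L 'a \<Rightarrow>\<^sub>L real" and \<gamma> \<Gamma> :: real
  assumes idem: "P (P v) = P v"
    and Vt_subspace: "subspace Vt" and Vt_closed: "closed Vt"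
    and b_symmetric: "symmetric_form b"
    and bt_symmetric: "symmetric_form bt" and bt_elliptic: "elliptic_on Vt bt"
    and covering: "range P \<subseteq> ker P + Vt"
    and constants: "0 < \<gamma>" "\<gamma> \<le> \<Gamma>"
    and lower: "\<gamma> * min_value (\<lambda>w. bt w w) ((P v +o ker P) \<inter> Vt) \<le> b (P v) (P v)"
    and upper: "b (P v) (P v) \<le> \<Gamma> * min_value (\<lambda>w. bt w w) ((P v +o ker P) \<inter> Vt)"
begin

lemma b_sym: "b u v = b v u"
  using b_symmetric unfolding symmetric_form_def by blast

lemma bt_sym: "bt u v = bt v u"
  using bt_symmetric unfolding symmetric_form_def by blast

lemma bt_nonneg: "v \<in> Vt \<Longrightarrow> 0 \<le> bt v v"
  using bt_elliptic unfolding elliptic_on_def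
  by (meson less_imp_le mult_nonneg_nonneg order_trans zero_le_power2)

lemma bt_eq_0D: "v \<in> Vt \<Longrightarrow> bt v v = 0 \<Longrightarrow> v = 0"
  using bt_elliptic unfolding elliptic_on_def
  by (metis mult_le_0_iff norm_eq_zero not_less zero_eq_power2 order_antisym zero_le_power2)

text \<open>
  The \<open>bt\<close>-orthogonal complement of \<open>Vt \<inter> ker P\<close> in \<open>Vt\<close>.  The name alludes to the Dirichlet
  principle: harmonic functions minimize the energy among those with the same boundary values, as
  the elements of this space do in their class modulo \<open>ker P\<close>.  In contrast to
  minimality itself, the condition is linear in \<open>z\<close>.
\<close>

definition harmonic :: "'a set" where
  "harmonic = {z \<in> Vt. \<forall>w\<in>Vt. P w = 0 \<longrightarrow> bt z w = 0}"

lemma harmonic_Vt: "z \<in> harmonic \<Longrightarrow> z \<in> Vt"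
  unfolding harmonic_def by simp

lemma subspace_harmonic: "subspace harmonic"
  unfolding harmonic_def using Vt_subspace
  by (auto simp: subspace_def blinfun.add_left blinfun.add_right blinfun.scaleR_left
      blinfun.scaleR_right blinfun.zero_right)

lemma harmonic_min:
  assumes z: "z \<in> harmonic" and w: "w \<in> Vt" "P w = P z"
  shows "bt z z \<le> bt w w"
proof -
  have d: "w - z \<in> Vt" "P (w - z) = 0"
    using Vt_subspace z w by (auto simp: harmonic_def blinfun.diff_right intro: subspace_diff)
  then have "bt z (w - z) = 0" using z unfolding harmonic_def by blast
  then have "bt w w = bt z z + bt (w - z) (w - z)"
    using bt_sym[of w z] by (simp add: blinfun.diff_left blinfun.diff_right)
  then show ?thesis using bt_nonneg[OF d(1)] by simp
qed

lemma min_value_harmonic: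
  assumes "z \<in> harmonic"
  shows "min_value (\<lambda>w. bt w w) ((P z +o ker P) \<inter> Vt) = bt z z"
  unfolding min_value_def
proof (rule Least_equality)
  show "bt z z \<in> (\<lambda>w. bt w w) ` ((P z +o ker P) \<inter> Vt)"
    using assms by (auto simp: mem_coset_ker_iff idem harmonic_Vt)
  show "bt z z \<le> r" if "r \<in> (\<lambda>w. bt w w) ` ((P z +o ker P) \<inter> Vt)" for r
    using that harmonic_min[OF assms] by (auto simp: mem_coset_ker_iff idem)
qed

lemma quot_form_harmonic:
  assumes "z \<in> harmonic"
  shows "quot_form bt Vt (z +o ker P) = bt z z"
  unfolding quot_form_def
proof (rule cInf_eq_minimum)
  show "bt z z \<in> (\<lambda>w. bt w w) ` ((z +o ker P) \<inter> Vt)"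
    using assms by (auto simp: mem_coset_ker_iff harmonic_Vt)
  show "bt z z \<le> r" if "r \<in> (\<lambda>w. bt w w) ` ((z +o ker P) \<inter> Vt)" for r
    using that harmonic_min[OF assms] by (auto simp: mem_coset_ker_iff)
qed

text \<open>
  The equivalence of the forms, freed from the minimum: this is what makes the bounds applicable to
  linear combinations.
\<close>

lemma forms_equivalent:
  assumes "z \<in> harmonic"
  shows "\<gamma> * bt z z \<le> b (P z) (P z)" "b (P z) (P z) \<le> \<Gamma> * bt z z"
  using lower[of z] upper[of z] min_value_harmonic[OF assms] by simp_all

text \<open>
  The covering hypothesis makes the affine space \<open>{w \<in> Vt. P w = P v}\<close> nonempty; its element of
  least energy is stationary in the directions of \<open>Vt \<inter> ker P\<close>.
\<close>

lemma harmonic_representative: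
  obtains z where "z \<in> harmonic" "P z = P v"
proof -
  let ?C = "{w \<in> Vt. P w = P v}"
  have "P v \<in> ker P + Vt" using covering by blast
  then obtain n w where "P n = 0" "w \<in> Vt" "P v = n + w"
    by (auto elim: set_plus_elim)
  then have "P (P v) = P w" by (simp add: blinfun.add_right)
  then have "w \<in> ?C" using \<open>w \<in> Vt\<close> by (simp add: idem)
  then have ne: "?C \<noteq> {}" by blast
  have "?C = Vt \<inter> {w. P w = P v}" by blast
  moreover have "closed {w. P w = P v}"
    by (intro closed_Collect_eq continuous_intros)
  ultimately have "closed ?C" using Vt_closed closed_Int by simp
  moreover have "convex ?C"
    using subspace_imp_convex[OF Vt_subspace]
    by (auto simp: convex_def blinfun.add_right blinfun.scaleR_right scaleR_add_left[symmetric])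
  ultimately obtain z where
    z: "is_arg_min (\<lambda>w. (1/2) * bt w w + blinfun_apply 0 w) (\<lambda>w. w \<in> ?C) z"
    using quadratic_form_attains_min[OF Vt_subspace bt_symmetric bt_elliptic, of ?C 0] ne by blast
  have "bt z w = 0" if w: "w \<in> Vt" "P w = 0" for w
  proof -
    have "bt z w + blinfun_apply 0 w = 0"
    proof (rule quadratic_form_min_stationary[OF bt_symmetric])
      fix t
      have "z + t *\<^sub>R w \<in> ?C"
        using z w Vt_subspace
        by (auto simp: is_arg_min_def blinfun.add_right blinfun.scaleR_right
            intro!: subspace_add subspace_scale)
      then show "(1/2) * bt z z + blinfun_apply 0 z
          \<le> (1/2) * bt (z + t *\<^sub>R w) (z + t *\<^sub>R w) + blinfun_apply 0 (z + t *\<^sub>R w)"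
        using z unfolding is_arg_min_linorder by blast
    qed
    then show ?thesis by simp
  qed
  then show ?thesis using z that unfolding is_arg_min_def harmonic_def by blast
qed

section \<open>One step with exact line search\<close>

text \<open>
  In the inner product induced by \<open>bt\<close>, such a \<open>y\<close> represents the negative gradient of
  \<open>v \<mapsto> 1/2 b v v\<close> at the error \<open>e\<close>.
\<close>

definition descent_direction :: "'a \<Rightarrow> 'a \<Rightarrow> bool" where
  "descent_direction e y \<longleftrightarrow> y \<in> Vt \<and> (\<forall>w\<in>Vt. bt y w = - b e (P w))"

lemma descent_direction_harmonic: "descent_direction e y \<Longrightarrow> y \<in> harmonic"
  unfolding descent_direction_def harmonic_def by (simp add: blinfun.zero_right)

text \<open>
  The bounds of \<open>forms_equivalent\<close> for all \<open>s z - t y\<close>, where \<open>z\<close> is the harmonic representative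
  of \<open>e\<close>, are the hypotheses of the moment inequality.  If \<open>P y = 0\<close>, then \<open>y = 0\<close>, so that
  \<open>b e e = - bt y z = 0\<close> and there is no error left to reduce.
\<close>

lemma exact_step_contracts:
  assumes e: "P e = e" and y: "descent_direction e y"
  shows "form_norm b (if P y = 0 then e else e + (- b e (P y) / b (P y) (P y)) *\<^sub>R P y)
           \<le> (\<Gamma> - \<gamma>) / (\<Gamma> + \<gamma>) * form_norm b e"
proof -
  obtain z where z: "z \<in> harmonic" and Pz: "P z = e"
    using harmonic_representative[of e] e by auto
  have yh: "y \<in> harmonic" using y by (rule descent_direction_harmonic)
  have y_eq: "bt y w = - b e (P w)" if "w \<in> Vt" for w
    using y that unfolding descent_direction_def by blast
  define m\<^sub>0 m\<^sub>1 m\<^sub>2 m\<^sub>3 where "m\<^sub>0 = bt z z" "m\<^sub>1 = b e e" "m\<^sub>2 = bt y y" "m\<^sub>3 = b (P y) (P y)"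
  note m_defs = this
  have yz: "bt y z = - m\<^sub>1" "bt z y = - m\<^sub>1"
    using y_eq[OF harmonic_Vt[OF z]] bt_sym[of y z] Pz by (simp_all add: m_defs)
  have ey: "b e (P y) = - m\<^sub>2" "b (P y) e = - m\<^sub>2"
    using y_eq[OF harmonic_Vt[OF yh]] b_sym[of e "P y"] by (simp_all add: m_defs)
  have m1: "0 \<le> m\<^sub>1"
    using forms_equivalent(1)[OF z] bt_nonneg[OF harmonic_Vt[OF z]] constants(1) Pz
    by (metis m_defs(2) mult_nonneg_nonneg less_imp_le order_trans)
  show ?thesis
  proof (cases "P y = 0")
    case True
    then have "bt y y = 0"
      using y_eq[OF harmonic_Vt[OF yh]] by (simp add: blinfun.zero_right)
    then have "y = 0" using bt_eq_0D harmonic_Vt[OF yh] by blast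
    then have "m\<^sub>1 = 0" using yz by (simp add: blinfun.zero_left)
    then show ?thesis using True by (simp add: form_norm_def m_defs)
  next
    case False
    then have "y \<noteq> 0" by (auto simp: blinfun.zero_right)
    then have "0 < bt y y"
      using bt_nonneg bt_eq_0D harmonic_Vt[OF yh] by (metis order_le_less)
    then have m3: "0 < m\<^sub>3"
      using forms_equivalent(1)[OF yh] constants(1)
      by (metis m_defs(4) mult_pos_pos order_less_le_trans)
    \<comment> \<open>The sign of \<open>t\<close> reflects that \<open>- y\<close>, not \<open>y\<close>, is the image of \<open>z\<close>
      under the operator representing \<open>b\<close>.\<close>
    have w: "s *\<^sub>R z - t *\<^sub>R y \<in> harmonic" for s t
      using subspace_harmonic z yh by (intro subspace_diff subspace_scale)
    have bt_w: "bt (s *\<^sub>R z - t *\<^sub>R y) (s *\<^sub>R z - t *\<^sub>R y)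
        = s\<^sup>2 * m\<^sub>0 + 2 * s * t * m\<^sub>1 + t\<^sup>2 * m\<^sub>2" for s t
      by (simp add: blinfun.diff_left blinfun.diff_right blinfun.scaleR_left blinfun.scaleR_right
          yz m_defs(1,3) power2_eq_square algebra_simps)
    have b_w: "b (P (s *\<^sub>R z - t *\<^sub>R y)) (P (s *\<^sub>R z - t *\<^sub>R y))
        = s\<^sup>2 * m\<^sub>1 + 2 * s * t * m\<^sub>2 + t\<^sup>2 * m\<^sub>3" for s t
      by (simp add: blinfun.diff_left blinfun.diff_right blinfun.scaleR_left blinfun.scaleR_right
          Pz ey m_defs(2,4) power2_eq_square algebra_simps)
    have "m\<^sub>3 + \<gamma> * \<Gamma> * m\<^sub>1 \<le> (\<gamma> + \<Gamma>) * m\<^sub>2"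
      by (rule third_moment_le[OF constants, of m\<^sub>0])
        (use forms_equivalent[OF w] in \<open>simp_all only: bt_w b_w\<close>)
    then have red: "m\<^sub>1 - m\<^sub>2\<^sup>2 / m\<^sub>3 \<le> ((\<Gamma> - \<gamma>) / (\<Gamma> + \<gamma>))\<^sup>2 * m\<^sub>1"
      by (rule exact_line_search_reduction[OF constants m1 m3])
    let ?e' = "e + (- b e (P y) / b (P y) (P y)) *\<^sub>R P y"
    have "b ?e' ?e' = m\<^sub>1 - m\<^sub>2\<^sup>2 / m\<^sub>3"
      using m3 by (simp add: blinfun.add_left blinfun.add_right blinfun.scaleR_left
          blinfun.scaleR_right ey flip: m_defs) (simp add: field_simps power2_eq_square)
    then have "form_norm b ?e' \<le> sqrt (((\<Gamma> - \<gamma>) / (\<Gamma> + \<gamma>))\<^sup>2 * m\<^sub>1)"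
      unfolding form_norm_def using red by simp
    also have "\<dots> = (\<Gamma> - \<gamma>) / (\<Gamma> + \<gamma>) * form_norm b e"
      using constants by (simp add: real_sqrt_mult form_norm_def m_defs)
    finally show ?thesis using False by simp
  qed
qed

end

section \<open>The primal dual projection algorithm\<close>

text \<open>
  The assumption \<open>dq_eq\<close> combines the optimality of \<open>xs\<close>, namely \<open>q'(xs) = 0\<close> on the range of \<open>P\<close>,
  with the constancy of \<open>q''\<close>.
\<close>

locale quadratic_problem = equivalent_forms P Vt b bt \<gamma> \<Gamma>
  for P :: "'a::{real_inner, complete_space} \<Rightarrow>\<^sub>L 'a" and Vt b bt \<gamma> \<Gamma> +
  fixes q :: "'a \<Rightarrow> real" and dq :: "'a \<Rightarrow> 'a \<Rightarrow>\<^sub>L real" and xs :: 'a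
  assumes dq: "(q has_derivative dq x) (at x)"
    and b: "(dq has_derivative b) (at x)"
    and dq_eq: "dq x (P v) = b (x - xs) (P v)"
    and xs: "P xs = xs"
begin

definition local_model :: "'a \<Rightarrow> 'a \<Rightarrow> real" where
  "local_model x v = (1/2) * bt v v + dq x (P v)"

lemma local_model_min_exists: "\<exists>y. is_arg_min (local_model x) (\<lambda>v. v \<in> Vt) y"
proof -
  have "local_model x = (\<lambda>v. (1/2) * bt v v + (dq x o\<^sub>L P) v)"
    by (simp add: local_model_def fun_eq_iff)
  then show ?thesis
    using quadratic_form_attains_min[OF Vt_subspace bt_symmetric bt_elliptic subset_refl Vt_closed
        subspace_imp_convex[OF Vt_subspace], of "dq x o\<^sub>L P"] subspace_0[OF Vt_subspace]
    by auto
qed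

lemma local_model_min_descent_direction:
  assumes y: "is_arg_min (local_model x) (\<lambda>v. v \<in> Vt) y"
  shows "descent_direction (x - xs) y"
  unfolding descent_direction_def
proof (intro conjI ballI)
  show yV: "y \<in> Vt" using y unfolding is_arg_min_def by blast
  fix w assume w: "w \<in> Vt"
  have "bt y w + (dq x o\<^sub>L P) w = 0"
  proof (rule quadratic_form_min_stationary[OF bt_symmetric])
    fix t
    have "y + t *\<^sub>R w \<in> Vt"
      using yV w Vt_subspace by (intro subspace_add subspace_scale)
    then have "local_model x y \<le> local_model x (y + t *\<^sub>R w)"
      using y unfolding is_arg_min_linorder by blast
    then show "(1/2) * bt y y + (dq x o\<^sub>L P) y
        \<le> (1/2) * bt (y + t *\<^sub>R w) (y + t *\<^sub>R w) + (dq x o\<^sub>L P) (y + t *\<^sub>R w)"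
      by (simp add: local_model_def)
  qed
  then show "bt y w = - b (x - xs) (P w)" by (simp add: dq_eq)
qed

lemma local_model_step_contracts:
  assumes x: "P x = x" and y: "is_arg_min (local_model x) (\<lambda>v. v \<in> Vt) y"
  shows "form_norm b ((if P y = 0 then x else x + (- dq x (P y) / b (P y) (P y)) *\<^sub>R P y) - xs)
           \<le> (\<Gamma> - \<gamma>) / (\<Gamma> + \<gamma>) * form_norm b (x - xs)"
proof -
  have "P (x - xs) = x - xs" by (simp add: blinfun.diff_right x xs)
  from exact_step_contracts[OF this local_model_min_descent_direction[OF y]]
  show ?thesis by (simp add: dq_eq algebra_simps split: if_splits)
qed

text \<open>
  Adding the multiplier \<open>q'(x) \<circ> P - q'(x)\<close> to \<open>q'(x)\<close> leaves \<open>q'(x) \<circ> P\<close>, so the objective of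
  the algorithm is the local model.
\<close>

lemma pdp_step_eq:
  obtains y where "is_arg_min (local_model x) (\<lambda>v. v \<in> Vt) y"
    and "pdp_step dq b bt Vt P x
           = (if P y = 0 then x else x + (- dq x (P y) / b (P y) (P y)) *\<^sub>R P y)"
proof
  let ?y = "arg_min_on (local_model x) Vt"
  show "is_arg_min (local_model x) (\<lambda>v. v \<in> Vt) ?y"
    unfolding arg_min_on_def arg_min_def using local_model_min_exists by (rule someI_ex)
  have "(\<lambda>v. dq x v + (1/2) * bt v v + pdp_multiplier dq P x v) = local_model x"
    by (simp add: fun_eq_iff local_model_def pdp_multiplier_def dual_adjoint_def blinfun.diff_left)
  then show "pdp_step dq b bt Vt P x
      = (if P ?y = 0 then x else x + (- dq x (P ?y) / b (P ?y) (P ?y)) *\<^sub>R P ?y)"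
    unfolding pdp_step_def by (simp add: Let_def)
qed

lemma pdp_range: "P x0 = x0 \<Longrightarrow> P (pdp dq b bt Vt P x0 k) = pdp dq b bt Vt P x0 k"
proof (induction k)
  case (Suc k)
  let ?x = "pdp dq b bt Vt P x0 k"
  obtain y where "pdp_step dq b bt Vt P ?x
      = (if P y = 0 then ?x else ?x + (- dq ?x (P y) / b (P y) (P y)) *\<^sub>R P y)"
    by (rule pdp_step_eq)
  then show ?case using Suc by (simp add: blinfun.diff_right blinfun.scaleR_right idem)
qed simp

lemma pdp_contracts:
  assumes "P x0 = x0"
  shows "form_norm b (pdp dq b bt Vt P x0 (Suc k) - xs)
           \<le> (\<Gamma> - \<gamma>) / (\<Gamma> + \<gamma>) * form_norm b (pdp dq b bt Vt P x0 k - xs)"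
proof -
  let ?x = "pdp dq b bt Vt P x0 k"
  obtain y where y: "is_arg_min (local_model ?x) (\<lambda>v. v \<in> Vt) y"
    and step: "pdp_step dq b bt Vt P ?x
      = (if P y = 0 then ?x else ?x + (- dq ?x (P y) / b (P y) (P y)) *\<^sub>R P y)"
    by (rule pdp_step_eq)
  show ?thesis
    unfolding pdp.simps(2) step by (rule local_model_step_contracts[OF pdp_range[OF assms] y])
qed

section \<open>Steepest descent in the quotient space\<close>

definition quot_model :: "'a set \<Rightarrow> 'a set \<Rightarrow> real" where
  "quot_model A B = (1/2) * quot_form bt Vt B + quot_f' q P A B"

lemma quot_model_harmonic:
  assumes "z \<in> harmonic"
  shows "quot_model (\<xi> +o ker P) (z +o ker P) = local_model (P \<xi>) z"
  unfolding quot_model_def local_model_def quot_form_harmonic[OF assms] quot_f'_eq[OF dq] ..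

lemma harmonic_coset:
  assumes "B \<in> quotient_space (ker P)"
  obtains z where "z \<in> harmonic" "B = z +o ker P"
proof -
  obtain v where v: "B = v +o ker P" using assms unfolding quotient_space_def by blast
  obtain z where z: "z \<in> harmonic" "P z = P v" by (rule harmonic_representative)
  then have "B = z +o ker P" unfolding v by (auto simp: mem_coset_ker_iff)
  then show ?thesis using that z by blast
qed

lemma quot_model_min_exists:
  "\<exists>D. is_arg_min (quot_model (\<xi> +o ker P)) (\<lambda>B. B \<in> quotient_space (ker P)) D"
proof -
  obtain y where y: "is_arg_min (local_model (P \<xi>)) (\<lambda>v. v \<in> Vt) y"
    using local_model_min_exists by blast
  have yh: "y \<in> harmonic"
    using local_model_min_descent_direction[OF y] by (rule descent_direction_harmonic)
  have "quot_model (\<xi> +o ker P) (y +o ker P) \<le> quot_model (\<xi> +o ker P) B"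
    if "B \<in> quotient_space (ker P)" for B
  proof -
    obtain z where z: "z \<in> harmonic" "B = z +o ker P" using harmonic_coset[OF \<open>B \<in> _\<close>] .
    then show ?thesis
      using y harmonic_Vt by (simp add: quot_model_harmonic yh is_arg_min_linorder)
  qed
  moreover have "y +o ker P \<in> quotient_space (ker P)" unfolding quotient_space_def by blast
  ultimately show ?thesis unfolding is_arg_min_linorder by blast
qed

text \<open>
  Take the harmonic representative \<open>y\<close> of \<open>D\<close>.  Replacing a competitor \<open>v \<in> Vt\<close> by the harmonic
  representative of its class does not increase the local model, and on harmonic elements the local
  model and the quotient model agree.
\<close>

lemma quot_model_min_lift:
  assumes D: "is_arg_min (quot_model (\<xi> +o ker P)) (\<lambda>B. B \<in> quotient_space (ker P)) D"
  obtains y where "is_arg_min (local_model (P \<xi>)) (\<lambda>v. v \<in> Vt) y" "D = y +o ker P"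
proof -
  have DQ: "D \<in> quotient_space (ker P)" using D unfolding is_arg_min_def by blast
  obtain y where y: "y \<in> harmonic" "D = y +o ker P" using harmonic_coset[OF DQ] .
  have "local_model (P \<xi>) y \<le> local_model (P \<xi>) v" if v: "v \<in> Vt" for v
  proof -
    obtain z where z: "z \<in> harmonic" "P z = P v" by (rule harmonic_representative)
    have "local_model (P \<xi>) y = quot_model (\<xi> +o ker P) D"
      by (simp add: quot_model_harmonic y)
    also have "\<dots> \<le> quot_model (\<xi> +o ker P) (z +o ker P)"
      using D unfolding is_arg_min_linorder quotient_space_def by blast
    also have "\<dots> = local_model (P \<xi>) z" using z(1) by (rule quot_model_harmonic)
    also have "\<dots> \<le> local_model (P \<xi>) v"
      using harmonic_min[OF z(1) v] z(2) by (simp add: local_model_def)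
    finally show ?thesis .
  qed
  then show ?thesis
    using that y harmonic_Vt unfolding is_arg_min_linorder by blast
qed

lemma sd_step_eq:
  obtains y where "is_arg_min (local_model (P \<xi>)) (\<lambda>v. v \<in> Vt) y"
    and "sd_step q bt Vt P (\<xi> +o ker P)
           = (if P y = 0 then \<xi> else \<xi> + (- dq (P \<xi>) (P y) / b (P y) (P y)) *\<^sub>R y) +o ker P"
proof -
  define D where "D = arg_min_on (quot_model (\<xi> +o ker P)) (quotient_space (ker P))"
  have D: "is_arg_min (quot_model (\<xi> +o ker P)) (\<lambda>B. B \<in> quotient_space (ker P)) D"
    unfolding D_def arg_min_on_def arg_min_def using quot_model_min_exists by (rule someI_ex)
  obtain y where y: "is_arg_min (local_model (P \<xi>)) (\<lambda>v. v \<in> Vt) y" "D = y +o ker P"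
    using quot_model_min_lift[OF D] .
  have zero: "D = ker P \<longleftrightarrow> P y = 0"
    unfolding y(2) set_eq_iff by (auto simp: mem_coset_ker_iff)
  have "sd_step q bt Vt P (\<xi> +o ker P)
      = (if D = ker P then \<xi> +o ker P
         else (\<xi> +o ker P) + coset_scale (ker P)
           (- quot_f' q P (\<xi> +o ker P) D / quot_f'' q P (\<xi> +o ker P) D D) D)"
    unfolding sd_step_def Let_def D_def quot_model_def[abs_def] ..
  also have "\<dots> = (if P y = 0 then \<xi> else \<xi> + (- dq (P \<xi>) (P y) / b (P y) (P y)) *\<^sub>R y) +o ker P"
    unfolding zero unfolding y(2) quot_f'_eq[OF dq] quot_f''_eq[OF dq b] coset_add_scale by simp
  finally have "sd_step q bt Vt P (\<xi> +o ker P)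
      = (if P y = 0 then \<xi> else \<xi> + (- dq (P \<xi>) (P y) / b (P y) (P y)) *\<^sub>R y) +o ker P" .
  with y(1) show ?thesis by (rule that)
qed

lemma sd_coset:
  assumes "Xi0 \<in> quotient_space (ker P)"
  obtains \<xi> where "sd q bt Vt P Xi0 k = \<xi> +o ker P"
proof -
  have "\<exists>\<xi>. sd q bt Vt P Xi0 k = \<xi> +o ker P"
  proof (induction k)
    case 0
    then show ?case using assms unfolding quotient_space_def by auto
  next
    case (Suc k)
    then show ?case by (metis sd.simps(2) sd_step_eq)
  qed
  then show ?thesis using that by blast
qed

lemma quot_norm_coset_minus:
  "quot_norm b P (coset_minus (ker P) (\<xi> +o ker P) (xs +o ker P)) = form_norm b (P \<xi> - xs)"
  unfolding coset_minus_def coset_add_scale quot_norm_coset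
  by (simp add: blinfun.diff_right xs)

lemma sd_contracts:
  assumes "Xi0 \<in> quotient_space (ker P)"
  shows "quot_norm b P (coset_minus (ker P) (sd q bt Vt P Xi0 (Suc k)) (xs +o ker P))
           \<le> (\<Gamma> - \<gamma>) / (\<Gamma> + \<gamma>)
              * quot_norm b P (coset_minus (ker P) (sd q bt Vt P Xi0 k) (xs +o ker P))"
proof -
  obtain \<xi> where \<xi>: "sd q bt Vt P Xi0 k = \<xi> +o ker P" using sd_coset[OF assms] .
  obtain y where y: "is_arg_min (local_model (P \<xi>)) (\<lambda>v. v \<in> Vt) y"
    and step: "sd_step q bt Vt P (\<xi> +o ker P)
           = (if P y = 0 then \<xi> else \<xi> + (- dq (P \<xi>) (P y) / b (P y) (P y)) *\<^sub>R y) +o ker P"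
    by (rule sd_step_eq)
  have "P (if P y = 0 then \<xi> else \<xi> + (- dq (P \<xi>) (P y) / b (P y) (P y)) *\<^sub>R y)
      = (if P y = 0 then P \<xi> else P \<xi> + (- dq (P \<xi>) (P y) / b (P y) (P y)) *\<^sub>R P y)"
    by (simp only: blinfun.add_right blinfun.scaleR_right split: if_split) simp
  with local_model_step_contracts[OF idem y] show ?thesis
    by (simp only: sd.simps(2) \<xi> step quot_norm_coset_minus)
qed

end

section \<open>Linear convergence\<close>

theorem theorem4p3:
  fixes P :: "'a::{real_inner, complete_space} \<Rightarrow>\<^sub>L 'a"
    and q :: "'a \<Rightarrow> real"
    and dq :: "'a \<Rightarrow> 'a \<Rightarrow>\<^sub>L real"
    and b bt :: "'a \<Rightarrow>\<^sub>L 'a \<Rightarrow>\<^sub>L real"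
    and V W Vt Xi0 :: "'a set"
    and x0 xs :: 'a
    and \<gamma> \<Gamma> \<kappa> \<Theta> :: real
  assumes projection: "P o\<^sub>L P = P"
    and V: "V = range P"
    and W: "W = ker P"
    and q_cont: "continuous_on UNIV q"
    and q_quadratic: "quadratic q"
    and dq: "\<And>x. (q has_derivative dq x) (at x)"
    and b: "\<And>x. (dq has_derivative b) (at x)"
    and Vt_subspace: "subspace Vt"
    and Vt_closed: "closed Vt"
    and bt_symmetric: "symmetric_form bt"
    and bt_elliptic: "elliptic_on Vt bt"
    and V_subset: "V \<subseteq> W + Vt"
    and constants: "0 < \<gamma>" "\<gamma> \<le> \<Gamma>"
    and lower: "\<And>v. v \<in> V \<Longrightarrow> \<gamma> * min_value (\<lambda>w. bt w w) ((v +o W) \<inter> Vt) \<le> b v v"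
    and upper: "\<And>v. v \<in> V \<Longrightarrow> b v v \<le> \<Gamma> * min_value (\<lambda>w. bt w w) ((v +o W) \<inter> Vt)"
    and kappa: "\<kappa> = \<Gamma> / \<gamma>"
    and Theta: "\<Theta> = (\<kappa> - 1) / (\<kappa> + 1)"
    and minimizer: "is_arg_min q (\<lambda>x. x \<in> V) xs"
    and x0: "x0 \<in> V"
    and Xi0: "Xi0 \<in> quotient_space W" "x0 \<in> Xi0"
  shows "(\<forall>k. form_norm b (pdp dq b bt Vt P x0 (Suc k) - xs)
              \<le> \<Theta> * form_norm b (pdp dq b bt Vt P x0 k - xs)) \<and>
         (\<forall>k. quot_norm b P (coset_minus W (sd q bt Vt P Xi0 (Suc k)) (xs +o W))
              \<le> \<Theta> * quot_norm b P (coset_minus W (sd q bt Vt P Xi0 k) (xs +o W)))"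
proof -
  have idem: "P (P v) = P v" for v
    using arg_cong[OF projection, of "\<lambda>F. F v"] by simp
  note quad = quadratic_derivatives[OF q_quadratic dq b]
  have PV: "v \<in> V \<longleftrightarrow> P v = v" for v
    unfolding V using idem by (metis rangeE rangeI)
  have xsV: "xs \<in> V" and xs_min: "\<And>v. v \<in> V \<Longrightarrow> q xs \<le> q v"
    using minimizer unfolding is_arg_min_linorder by auto
  have stationary: "b xs (P v) + dq 0 (P v) = 0" for v
  proof (rule quadratic_form_min_stationary[OF quad(1)])
    fix t
    have "xs + t *\<^sub>R P v \<in> V"
      using xsV idem by (simp add: PV blinfun.add_right blinfun.scaleR_right)
    then show "(1/2) * b xs xs + dq 0 xs
        \<le> (1/2) * b (xs + t *\<^sub>R P v) (xs + t *\<^sub>R P v) + dq 0 (xs + t *\<^sub>R P v)"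
      using xs_min quad(3)[of xs] quad(3)[of "xs + t *\<^sub>R P v"] by fastforce
  qed
  have dq_eq: "dq x (P v) = b (x - xs) (P v)" for x v
    using quad(2)[of x "P v"] stationary[of v] by (simp add: blinfun.diff_left blinfun.diff_right)
  interpret quadratic_problem P Vt b bt \<gamma> \<Gamma> q dq xs
  proof
    fix v
    show "\<gamma> * min_value (\<lambda>w. bt w w) ((P v +o ker P) \<inter> Vt) \<le> b (P v) (P v)"
      using lower[of "P v"] V W by simp
    show "b (P v) (P v) \<le> \<Gamma> * min_value (\<lambda>w. bt w w) ((P v +o ker P) \<inter> Vt)"
      using upper[of "P v"] V W by simp
  qed (use assms quad(1) idem dq_eq xsV PV in auto)
  have "\<Theta> = (\<Gamma> - \<gamma>) / (\<Gamma> + \<gamma>)"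
  proof -
    have "\<Gamma> / \<gamma> - 1 = (\<Gamma> - \<gamma>) / \<gamma>" "\<Gamma> / \<gamma> + 1 = (\<Gamma> + \<gamma>) / \<gamma>"
      using constants by (simp_all add: field_simps)
    then show ?thesis using constants unfolding Theta kappa by simp
  qed
  then show ?thesis
    using pdp_contracts[of x0] sd_contracts[of Xi0] x0 Xi0 PV W by simp
qed

end
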